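(* Let $X$ be a finite set with $n:=|X|\ge 2$. Then $$\max\{D(\succsim,\succsim'):\ \succsim,\succsim'\in\mathbb{P}_{\text{total}}(X)\}=n2^{n-1}+2-2^{\lfloor n/2\rfloor}-2^{\lceil n/2\rceil}.$$
   Context: $\mathbb{P}_{\text{total}}(X)$ is the set of total preorders on $X$, i.e. binary relations $\succsim$ on $X$ that are reflexive, transitive and total (for all $x,y$, $x\succsim y$ or $y\succsim x$). For such $\succsim$, $\succ$ is its asymmetric part ($x\succ y$ iff $x\succsim y$ and not $y\succsim x$), and for $S\subseteq X$, $M(S,\succsim):=\{x\in S:\text{there is no }y\in S\text{ with }y\succ x\}$. The top-difference semimetric is $D(\succsim,\trianglerighteq):=\sum_{S\subseteq X}|M(S,\succsim)\triangle M(S,\trianglerighteq)|$. *)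

theory Defs
  imports Complex_Main
begin

text \<open>
  A relation \<open>R\<close> on \<open>X\<close> is a set of pairs, where \<open>(x, y) \<in> R\<close> means that \<open>x\<close> is weakly
  preferred to \<open>y\<close>; so the larger side of a comparison is the first component.
\<close>

text \<open>
  \<open>preorder_on\<close> includes \<open>R \<subseteq> X \<times> X\<close>. The library's \<open>total_on\<close> only compares distinct
  elements; the case \<open>x = y\<close> is covered by reflexivity.
\<close>

definition total_preorders :: "'a set \<Rightarrow> 'a rel set" where
  "total_preorders X = {R. preorder_on X R \<and> total_on X R}"

definition asym_part :: "'a rel \<Rightarrow> 'a rel" where
  "asym_part R = {(x, y). (x, y) \<in> R \<and> (y, x) \<notin> R}"

definition maximal_elems :: "'a set \<Rightarrow> 'a rel \<Rightarrow> 'a set" where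
  "maximal_elems S R = {x \<in> S. \<not> (\<exists>y\<in>S. (y, x) \<in> asym_part R)}"

definition top_diff :: "'a set \<Rightarrow> 'a rel \<Rightarrow> 'a rel \<Rightarrow> nat" where
  "top_diff X R R' =
     (\<Sum>S\<in>Pow X. card (sym_diff (maximal_elems S R) (maximal_elems S R')))"

text \<open>\<open>Max\<close> is only meaningful on finite nonempty sets.\<close>

lemma finite_total_preorders:
  assumes "finite X"
  shows "finite (total_preorders X)"
  by (rule finite_subset[of _ "Pow (X \<times> X)"])
    (use assms in \<open>auto simp: total_preorders_def preorder_on_def\<close>)

lemma total_preorders_nonempty: "X \<times> X \<in> total_preorders X"
  by (auto simp: total_preorders_def preorder_on_def refl_on_def total_on_def trans_def)

lemma top_diff_values_finite_nonempty:
  assumes "finite X"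
  defines "V \<equiv> {top_diff X R R' | R R'. R \<in> total_preorders X \<and> R' \<in> total_preorders X}"
  shows "finite V" and "V \<noteq> {}"
proof -
  have "V = (\<lambda>(R, R'). top_diff X R R') ` (total_preorders X \<times> total_preorders X)"
    unfolding V_def by auto
  then show "finite V" and "V \<noteq> {}"
    using finite_total_preorders[OF assms(1)] total_preorders_nonempty[of X] by auto
qed

end

theory Submission
  imports Defs
begin

text \<open>
  Since \<open>M(S, R) \<subseteq> S\<close>, the summand of \<open>S\<close> in \<open>top_diff\<close> is at most \<open>card S\<close>, and these
  cardinalities add up to \<open>n * 2 ^ (n - 1)\<close>. Equality for a nonempty \<open>S\<close> means that \<open>S\<close> is the
  disjoint union of its \<open>R\<close>-maximal and its \<open>R'\<close>-maximal elements; call \<open>S\<close> split in this case.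
  Every nonempty set that is not split loses at least \<open>1\<close>, so the upper bound reduces to showing
  that there are at most \<open>(2 ^ \<lfloor>n/2\<rfloor> - 1) * (2 ^ \<lceil>n/2\<rceil> - 1)\<close> split sets. This goes by induction:
  with \<open>C\<close> the top class of \<open>R\<close>, a split set \<open>S\<close> meeting \<open>C\<close> consists of a nonempty subset of \<open>C\<close>
  and a nonempty set of mutually \<open>R'\<close>-indifferent elements outside \<open>C\<close>. If all elements outside
  \<open>C\<close> are \<open>R'\<close>-indifferent, then every split set meets \<open>C\<close>; otherwise at most half of the sets
  outside \<open>C\<close> are eligible.

  The bound is attained by splitting \<open>X\<close> into halves \<open>A\<close> and \<open>B\<close>, where \<open>R\<close> has \<open>A\<close> tied at the
  top and \<open>B\<close> linearly ordered below, and \<open>R'\<close> has \<open>B\<close> tied at the top and \<open>A\<close> linearly ordered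
  below: the sets meeting both halves are split, and all other nonempty sets lose exactly \<open>1\<close>.
\<close>

section \<open>Counting over the power set\<close>

lemma sum_card_Pow:
  assumes "finite X"
  shows "(\<Sum>S\<in>Pow X. int (card S)) = int (card X) * 2 ^ (card X - 1)"
  using assms
proof (induction X)
  case empty
  then show ?case by simp
next
  case (insert x F)
  have inj: "inj_on (insert x) (Pow F)"
    using insert.hyps by (auto simp: inj_on_def)
  have "(\<Sum>S\<in>Pow (insert x F). int (card S))
      = (\<Sum>S\<in>Pow F. int (card S)) + (\<Sum>S\<in>insert x ` Pow F. int (card S))"
    unfolding Pow_insert using insert.hyps by (intro sum.union_disjoint) auto
  also have "(\<Sum>S\<in>insert x ` Pow F. int (card S)) = (\<Sum>S\<in>Pow F. int (card (insert x S)))"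
    using inj by (simp add: sum.reindex)
  also have "\<dots> = (\<Sum>S\<in>Pow F. int (card S) + 1)"
    using insert.hyps by (intro sum.cong refl) (subst card_insert_disjoint, auto dest: finite_subset)
  also have "\<dots> = (\<Sum>S\<in>Pow F. int (card S)) + 2 ^ card F"
    using insert.hyps by (simp add: sum.distrib card_Pow)
  finally show ?case
    using insert by (cases "card F") (simp_all add: algebra_simps)
qed

lemma int_card_Pow_minus_empty:
  "finite A \<Longrightarrow> int (card (Pow A - {{}})) = 2 ^ card A - 1"
  by (simp add: card_Pow of_nat_diff)

section \<open>Maximal elements of total preorders\<close>

lemma total_preorders_total:
  "R \<in> total_preorders X \<Longrightarrow> x \<in> X \<Longrightarrow> y \<in> X \<Longrightarrow> (x, y) \<in> R \<or> (y, x) \<in> R"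
  by (cases "x = y") (auto simp: total_preorders_def preorder_on_def refl_on_def total_on_def)

lemma total_preorders_trans:
  "R \<in> total_preorders X \<Longrightarrow> (x, y) \<in> R \<Longrightarrow> (y, z) \<in> R \<Longrightarrow> (x, z) \<in> R"
  by (auto simp: total_preorders_def preorder_on_def dest: transD)

lemma maximal_elems_eq_greatest:
  assumes "R \<in> total_preorders X" "S \<subseteq> X"
  shows "maximal_elems S R = {x \<in> S. \<forall>y\<in>S. (x, y) \<in> R}"
  using total_preorders_total[OF assms(1)] assms(2)
  unfolding maximal_elems_def asym_part_def by blast

lemma maximal_elems_subset: "maximal_elems S R \<subseteq> S"
  by (auto simp: maximal_elems_def)

lemma maximal_elems_nonempty:
  assumes R: "R \<in> total_preorders X" and "finite S" "S \<noteq> {}" "S \<subseteq> X"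
  shows "maximal_elems S R \<noteq> {}"
proof -
  from assms(2-) have "\<exists>x\<in>S. \<forall>y\<in>S. (x, y) \<in> R"
  proof (induction S rule: finite_ne_induct)
    case (singleton x)
    then show ?case using total_preorders_total[OF R] by auto
  next
    case (insert x F)
    then obtain z where z: "z \<in> F" "\<forall>y\<in>F. (z, y) \<in> R" by auto
    have "z \<in> X" "x \<in> X" using z insert.prems by auto
    then consider "(x, z) \<in> R" "(x, x) \<in> R" | "(z, x) \<in> R"
      using total_preorders_total[OF R] by blast
    then show ?case using z total_preorders_trans[OF R] by cases blast+
  qed
  then show ?thesis using maximal_elems_eq_greatest[OF R assms(4)] by auto
qed

text \<open>An element of \<open>S\<close> that is greatest in all of \<open>Y\<close> lies, by
  transitivity, below no greatest element of \<open>S\<close> without passing on its own greatness: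
  whatever is weakly above it is greatest in \<open>Y\<close> too.\<close>

lemma maximal_elems_Int:
  assumes R: "R \<in> total_preorders X" and "S \<subseteq> Y" "Y \<subseteq> X" "S \<inter> maximal_elems Y R \<noteq> {}"
  shows "maximal_elems S R = S \<inter> maximal_elems Y R"
proof -
  have S: "S \<subseteq> X" using assms by auto
  obtain z where "z \<in> S" "\<forall>y\<in>Y. (z, y) \<in> R"
    using assms(4) unfolding maximal_elems_eq_greatest[OF R assms(3)] by auto
  then have "(x, y) \<in> R" if "\<forall>w\<in>S. (x, w) \<in> R" "y \<in> Y" for x y
    using that total_preorders_trans[OF R, of x z y] by blast
  then show ?thesis
    using assms(2)
    unfolding maximal_elems_eq_greatest[OF R assms(3)] maximal_elems_eq_greatest[OF R S]
    by auto
qed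

section \<open>Split sets, cliques and the recursion over top classes\<close>

definition split_sets :: "'a set \<Rightarrow> 'a rel \<Rightarrow> 'a rel \<Rightarrow> 'a set set" where
  "split_sets Y R R' = {S. S \<subseteq> Y \<and> S \<noteq> {} \<and> maximal_elems S R \<inter> maximal_elems S R' = {} \<and>
     maximal_elems S R \<union> maximal_elems S R' = S}"

definition cliques :: "'a set \<Rightarrow> 'a rel \<Rightarrow> 'a set set" where
  "cliques Z R = {Q. Q \<subseteq> Z \<and> Q \<noteq> {} \<and> Q \<times> Q \<subseteq> R}"

text \<open>For \<open>y\<close> strictly above \<open>x\<close>, the map \<open>\<phi>\<close>
  sends cliques injectively to subsets of \<open>Z - {y}\<close>. Cliques without \<open>y\<close>
  stay fixed; the others go to the empty set or to a set that is no clique, so the two kinds of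
  image never collide.\<close>

lemma card_cliques_le:
  assumes R: "R \<in> total_preorders X" and "Z \<subseteq> X" "finite Z" "\<not> Z \<times> Z \<subseteq> R"
  shows "card (cliques Z R) \<le> 2 ^ (card Z - 1)"
proof -
  obtain x y where xy: "x \<in> Z" "y \<in> Z" "(x, y) \<notin> R" using assms(4) by auto
  have "x \<noteq> y" using total_preorders_total[OF R] xy assms(2) by blast
  define \<phi> where "\<phi> Q = (if y \<notin> Q then Q else if Q = {y} then {} else insert x (Q - {y}))" for Q
  have no_x: "x \<notin> Q" if "Q \<in> cliques Z R" "y \<in> Q" for Q
    using that xy by (auto simp: cliques_def)
  \<comment> \<open>Exchanging \<open>y\<close> for \<open>x\<close> turns a clique of size at least 2 into a set that is no clique.\<close>
  have not_clique: "\<not> insert x (Q - {y}) \<times> insert x (Q - {y}) \<subseteq> R"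
    if Q: "Q \<in> cliques Z R" "y \<in> Q" "Q \<noteq> {y}" for Q
  proof
    assume *: "insert x (Q - {y}) \<times> insert x (Q - {y}) \<subseteq> R"
    obtain z where "z \<in> Q" "z \<noteq> y" using Q by auto
    then have "(x, z) \<in> R" "(z, y) \<in> R" using * Q by (auto simp: cliques_def)
    then show False using total_preorders_trans[OF R] xy by blast
  qed
  have "inj_on \<phi> (cliques Z R)"
  proof (rule inj_onI)
    fix P Q assume P: "P \<in> cliques Z R" and Q: "Q \<in> cliques Z R" and eq: "\<phi> P = \<phi> Q"
    have ne: "P \<noteq> {}" "Q \<noteq> {}" and cl: "P \<times> P \<subseteq> R" "Q \<times> Q \<subseteq> R"
      using P Q by (auto simp: cliques_def)
    consider "y \<notin> P" "y \<notin> Q" | "y \<in> P" "y \<notin> Q" | "y \<notin> P" "y \<in> Q" | "y \<in> P" "y \<in> Q"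
      by blast
    then show "P = Q"
    proof cases
      case 1
      then show ?thesis using eq by (simp add: \<phi>_def)
    next
      case 2
      then show ?thesis using eq not_clique[OF P] ne cl by (auto simp: \<phi>_def split: if_splits)
    next
      case 3
      then show ?thesis using eq not_clique[OF Q] ne cl by (auto simp: \<phi>_def split: if_splits)
    next
      case 4
      then have "P - {y} = Q - {y}"
        using eq no_x[OF P] no_x[OF Q]
        by (simp add: \<phi>_def split: if_splits) (metis Diff_iff insert_ident)
      then show ?thesis using 4 by blast
    qed
  qed
  moreover have "\<phi> ` cliques Z R \<subseteq> Pow (Z - {y})"
    using xy \<open>x \<noteq> y\<close> by (auto simp: \<phi>_def cliques_def split: if_splits)
  ultimately have "card (cliques Z R) \<le> card (Pow (Z - {y}))"
    using assms(3) by (intro card_inj_on_le[where f = \<phi>]) auto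
  also have "\<dots> = 2 ^ (card Z - 1)" using xy assms(3) by (simp add: card_Pow)
  finally show ?thesis .
qed

text \<open>A split set \<open>S\<close> meeting \<open>C\<close> has \<open>S \<inter> C\<close> as
  its \<open>R\<close>-maximal part, so \<open>S - C\<close> is its \<open>R'\<close>-maximal part
  and hence a nonempty clique; the two parts determine \<open>S\<close>. A split set avoiding
  \<open>C\<close> is counted by the second summand.\<close>

lemma card_split_sets_step:
  assumes R: "R \<in> total_preorders X" and R': "R' \<in> total_preorders X"
    and "finite Y" "Y \<subseteq> X"
  defines "C \<equiv> maximal_elems Y R"
  shows "card (split_sets Y R R')
    \<le> (2 ^ card C - 1) * card (cliques (Y - C) R') + card (split_sets (Y - C) R R')"
proof -
  have CY: "C \<subseteq> Y" unfolding C_def by (rule maximal_elems_subset)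
  have finC: "finite C" using CY assms(3) by (rule finite_subset)
  define G where "G = {S \<in> split_sets Y R R'. S \<inter> C \<noteq> {}}"
  have finY: "finite (split_sets Y R R')"
    using assms(3) by (auto simp: split_sets_def intro: finite_subset[of _ "Pow Y"])
  have split: "split_sets Y R R' = G \<union> split_sets (Y - C) R R'"
    using CY by (auto simp: G_def split_sets_def)
  have "(\<lambda>S. (S \<inter> C, S - C)) ` G \<subseteq> (Pow C - {{}}) \<times> cliques (Y - C) R'"
  proof safe
    fix S assume "S \<in> G"
    then have S: "S \<subseteq> Y" "S \<inter> C \<noteq> {}" "S \<noteq> {}" "maximal_elems S R \<inter> maximal_elems S R' = {}"
      "maximal_elems S R \<union> maximal_elems S R' = S"
      by (auto simp: G_def split_sets_def)
    have SX: "S \<subseteq> X" and finS: "finite S" using S assms(3,4) by (auto intro: finite_subset)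
    have "maximal_elems S R = S \<inter> C"
      unfolding C_def using maximal_elems_Int[OF R S(1) assms(4)] S(2) by (simp add: C_def)
    then have M': "maximal_elems S R' = S - C" using S by blast
    moreover have "maximal_elems S R' \<noteq> {}"
      using maximal_elems_nonempty[OF R' finS S(3) SX] .
    ultimately show "S - C \<in> cliques (Y - C) R'"
      using S(1) maximal_elems_eq_greatest[OF R' SX] by (auto simp: cliques_def)
  qed (auto simp: G_def)
  moreover have "inj_on (\<lambda>S. (S \<inter> C, S - C)) G"
    by (auto simp: inj_on_def)
  moreover have "finite (cliques (Y - C) R')"
    using assms(3) by (auto simp: cliques_def intro: finite_subset[of _ "Pow Y"])
  ultimately have "card G \<le> card ((Pow C - {{}}) \<times> cliques (Y - C) R')"
    using finC by (intro card_inj_on_le[where f = "\<lambda>S. (S \<inter> C, S - C)"]) auto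
  also have "\<dots> = (2 ^ card C - 1) * card (cliques (Y - C) R')"
    using finC by (simp add: card_cartesian_product card_Pow)
  finally show ?thesis
    unfolding split using card_Un_le[of G "split_sets (Y - C) R R'"] by linarith
qed

section \<open>Arithmetic of the bound\<close>

text \<open>This is \<open>(2 ^ a - 1) * (2 ^ b - 1)\<close> for the halves
  \<open>a = n div 2\<close> and \<open>b = n - a\<close>, multiplied out over the integers to avoid
  truncated subtraction.\<close>

definition split_bound :: "nat \<Rightarrow> int" where
  "split_bound n = 2 ^ n - 2 ^ (n div 2) - 2 ^ (n - n div 2) + 1"

lemma split_bound_Suc: "split_bound (Suc n) = split_bound n + 2 ^ n - 2 ^ (n div 2)"
proof -
  have "Suc n div 2 = n - n div 2" "Suc n - Suc n div 2 = Suc (n div 2)" by linarith+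
  then show ?thesis by (simp add: split_bound_def)
qed

text \<open>Serves the case of at most \<open>2 ^ (m - 1)\<close> cliques below a top class of size
  \<open>c\<close>. Passing from \<open>c\<close> to \<open>Suc c\<close> adds
  \<open>2 ^ (c + m - 1)\<close> on the left and at least as much on the right.\<close>

lemma split_bound_half_step:
  assumes "m \<ge> 1" "c \<ge> 1"
  shows "2 ^ (c + m - 1) - 2 ^ (m - 1) + split_bound m \<le> split_bound (c + m)"
  using assms(2)
proof (induction c rule: dec_induct)
  case base
  have "(2::int) ^ (m div 2) \<le> 2 ^ (m - 1)" using assms(1) by (intro power_increasing) auto
  then show ?case by (simp add: split_bound_Suc)
next
  case (step c)
  have "(2::int) ^ ((c + m) div 2) \<le> 2 ^ (c + m - 1)" using assms(1) by (intro power_increasing) auto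
  moreover have "(2::int) ^ (c + m) = 2 * 2 ^ (c + m - 1)"
    using assms(1) by (simp flip: power_Suc)
  moreover have "split_bound (Suc c + m)
      = split_bound (c + m) + 2 ^ (c + m) - 2 ^ ((c + m) div 2)"
    by (simp add: split_bound_Suc)
  moreover have "Suc c + m - 1 = c + m" by simp
  ultimately show ?case using step.IH by (simp only:)
qed

text \<open>After expansion, this says that \<open>2 ^ c + 2 ^ m\<close> with \<open>c + m\<close>
  fixed is least when the exponents are balanced.\<close>

lemma split_bound_product: "(2 ^ c - 1) * (2 ^ m - 1) \<le> split_bound (c + m)"
proof -
  have *: "(2 ^ c - 1) * (2 ^ m - 1) \<le> split_bound (c + m)" if "c \<le> m" for c m :: nat
  proof -
    define a b d where "a = (c + m) div 2" and "b = c + m - a" and "d = a - c"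
    have "a = c + d" "m = b + d" "c \<le> b" using that unfolding a_def b_def d_def by linarith+
    \<comment> \<open>The product expands to
      \<open>(2 ^ c + 2 ^ m) - (2 ^ a + 2 ^ b)\<close>.\<close>
    moreover have "0 \<le> ((2::int) ^ b - 2 ^ c) * (2 ^ d - 1)"
      using \<open>c \<le> b\<close> by (intro mult_nonneg_nonneg) auto
    ultimately have "(2::int) ^ a + 2 ^ b \<le> 2 ^ c + 2 ^ m"
      by (simp add: algebra_simps power_add)
    then show ?thesis
      by (simp add: split_bound_def algebra_simps power_add flip: a_def b_def)
  qed
  show ?thesis
    using *[of c m] *[of m c] by (cases "c \<le> m") (simp_all add: add.commute mult.commute)
qed

section \<open>The upper bound\<close>

text \<open>Here every \<open>S\<close> consists entirely of \<open>R'\<close>-maximal elements,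
  which leaves no room for a disjoint nonempty \<open>R\<close>-maximal part.\<close>

lemma split_sets_clique:
  assumes R: "R \<in> total_preorders X" and R': "R' \<in> total_preorders X"
    and "finite Z" "Z \<subseteq> X" "Z \<times> Z \<subseteq> R'"
  shows "split_sets Z R R' = {}"
proof (rule equals0I)
  fix S assume "S \<in> split_sets Z R R'"
  then have S: "S \<subseteq> Z" "S \<noteq> {}" "maximal_elems S R \<inter> maximal_elems S R' = {}"
    by (auto simp: split_sets_def)
  have SX: "S \<subseteq> X" and "finite S" using S assms by (auto intro: finite_subset)
  have "maximal_elems S R' = S"
    using maximal_elems_eq_greatest[OF R' SX] S(1) assms(5) by blast
  then show False
    using S maximal_elems_subset[of S R] maximal_elems_nonempty[OF R \<open>finite S\<close> S(2) SX] by blast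
qed

text \<open>Induction on \<open>Y\<close>, removing its top \<open>R\<close>-class \<open>C\<close>.
  If the rest \<open>Z\<close> is a clique of \<open>R'\<close>, the recursive term vanishes and
  \<open>split_bound_product\<close> suffices; otherwise \<open>card_cliques_le\<close> and
  \<open>split_bound_half_step\<close> apply.\<close>

lemma card_split_sets_le:
  assumes R: "R \<in> total_preorders X" and R': "R' \<in> total_preorders X"
    and "finite Y" "Y \<subseteq> X"
  shows "int (card (split_sets Y R R')) \<le> split_bound (card Y)"
  using assms(3,4)
proof (induction Y rule: finite_psubset_induct)
  case (psubset Y)
  show ?case
  proof (cases "Y = {}")
    case True
    then show ?thesis by (simp add: split_sets_def split_bound_def)
  next
    case False
    define C where "C = maximal_elems Y R"
    define Z where "Z = Y - C"
    have C: "C \<subseteq> Y" "C \<noteq> {}"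
      unfolding C_def using maximal_elems_subset[of Y R]
        maximal_elems_nonempty[OF R psubset.hyps(1) False psubset.prems] by auto
    have fin: "finite C" "finite Z" and ZX: "Z \<subseteq> X"
      using C psubset.hyps psubset.prems by (auto simp: Z_def intro: finite_subset)
    have Y: "card Y = card C + card Z"
      unfolding Z_def using C fin psubset.hyps
      by (simp add: card_Diff_subset card_mono)
    have step: "int (card (split_sets Y R R'))
        \<le> (2 ^ card C - 1) * int (card (cliques Z R')) + int (card (split_sets Z R R'))"
      using of_nat_mono[where ?'a = int,
          OF card_split_sets_step[OF R R' psubset.hyps(1) psubset.prems]]
      unfolding Z_def C_def by (simp add: of_nat_diff)
    show ?thesis
    proof (cases "Z \<times> Z \<subseteq> R'")
      case True
      have "cliques Z R' \<subseteq> Pow Z - {{}}" by (auto simp: cliques_def)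
      then have "card (cliques Z R') \<le> card (Pow Z - {{}})"
        using fin by (intro card_mono) auto
      from of_nat_mono[where ?'a = int, OF this]
      have "int (card (cliques Z R')) \<le> 2 ^ card Z - 1"
        by (simp only: int_card_Pow_minus_empty[OF fin(2)])
      then have "(2 ^ card C - 1) * int (card (cliques Z R'))
          \<le> (2 ^ card C - 1) * (2 ^ card Z - 1)"
        by (intro mult_left_mono) auto
      then show ?thesis
        using step split_sets_clique[OF R R' fin(2) ZX True]
          split_bound_product[of "card C" "card Z"] by (simp add: Y)
    next
      case False
      then have "Z \<noteq> {}" by auto
      then have pos: "card Z \<ge> 1" "card C \<ge> 1"
        using fin C by (simp_all add: Suc_le_eq card_gt_0_iff)
      have "int (card (cliques Z R')) \<le> 2 ^ (card Z - 1)"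
        using of_nat_mono[where ?'a = int, OF card_cliques_le[OF R' ZX fin(2) False]] by simp
      then have "(2 ^ card C - 1) * int (card (cliques Z R'))
          \<le> (2 ^ card C - 1) * 2 ^ (card Z - 1)"
        by (intro mult_left_mono) auto
      also have "\<dots> = 2 ^ (card C + card Z - 1) - 2 ^ (card Z - 1)"
        using pos by (simp add: algebra_simps flip: power_add)
      finally have "(2 ^ card C - 1) * int (card (cliques Z R'))
          \<le> 2 ^ (card C + card Z - 1) - 2 ^ (card Z - 1)" .
      moreover have "int (card (split_sets Z R R')) \<le> split_bound (card Z)"
        using C ZX by (intro psubset.IH) (auto simp: Z_def)
      ultimately show ?thesis
        using step split_bound_half_step[OF pos] by (simp add: Y)
    qed
  qed
qed

text \<open>By \<open>card_split_sets_le\<close>, at least \<open>2 ^ a + 2 ^ b - 2\<close> nonempty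
  sets are not split, where \<open>a\<close> and \<open>b\<close> are the halves of
  \<open>card X\<close>; each of them costs at least 1.\<close>

lemma top_diff_le:
  assumes R: "R \<in> total_preorders X" and R': "R' \<in> total_preorders X" and fin: "finite X"
  shows "int (top_diff X R R')
    \<le> int (card X) * 2 ^ (card X - 1) + 2 - 2 ^ (card X div 2) - 2 ^ (card X - card X div 2)"
proof -
  let ?D = "\<lambda>S. sym_diff (maximal_elems S R) (maximal_elems S R')"
  let ?L = "Pow X - {{}} - split_sets X R R'"
  have sub: "split_sets X R R' \<subseteq> Pow X - {{}}" by (auto simp: split_sets_def)
  have le: "int (card (?D S)) + (if S \<in> ?L then 1 else 0) \<le> int (card S)" if "S \<in> Pow X" for S
  proof -
    have finS: "finite S" using that fin by (auto intro: finite_subset)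
    have D: "?D S \<subseteq> S" using maximal_elems_subset[of S] by blast
    show ?thesis
    proof (cases "S \<in> ?L")
      case True
      then have "?D S \<noteq> S" using that maximal_elems_subset[of S] by (auto simp: split_sets_def)
      then have "card (?D S) < card S" using D finS by (intro psubset_card_mono) auto
      then show ?thesis by (subst if_P[OF True]) simp
    next
      case False
      then show ?thesis using card_mono[OF finS D] by (subst if_not_P[OF False]) simp
    qed
  qed
  have "(\<Sum>S\<in>Pow X. int (card (?D S)) + (if S \<in> ?L then 1 else 0)) \<le> (\<Sum>S\<in>Pow X. int (card S))"
    using le by (intro sum_mono) blast
  moreover have "(\<Sum>S\<in>Pow X. if S \<in> ?L then 1 else 0 :: int) = int (card ?L)"
  proof -
    have "Pow X \<inter> ?L = ?L" by auto
    then show ?thesis using fin by (simp add: sum.If_cases Collect_mem_eq del: Diff_iff)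
  qed
  moreover have "int (card ?L) = 2 ^ card X - 1 - int (card (split_sets X R R'))"
  proof -
    have "finite (Pow X - {{}})" using fin by simp
    then have "card ?L + card (split_sets X R R') = card (Pow X - {{}})"
      using sub by (metis card_Diff_subset card_mono finite_subset le_add_diff_inverse2)
    then show ?thesis using int_card_Pow_minus_empty[OF fin] by linarith
  qed
  ultimately show ?thesis
    using card_split_sets_le[OF R R' fin order_refl] sum_card_Pow[OF fin]
    by (simp add: sum.distrib top_diff_def split_bound_def)
qed

section \<open>The extremal pair\<close>

text \<open>Smaller ranks are better, so rank 0 marks the top class.\<close>

definition rank_preorder :: "'a set \<Rightarrow> ('a \<Rightarrow> nat) \<Rightarrow> 'a rel" where
  "rank_preorder X f = {(x, y). x \<in> X \<and> y \<in> X \<and> f x \<le> f y}"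

lemma rank_preorder_total: "rank_preorder X f \<in> total_preorders X"
  by (auto simp: rank_preorder_def total_preorders_def preorder_on_def refl_on_def total_on_def
      trans_def)

lemma maximal_elems_rank_preorder:
  assumes "S \<subseteq> X"
  shows "maximal_elems S (rank_preorder X f) = {x \<in> S. \<forall>y\<in>S. f x \<le> f y}"
  using assms unfolding maximal_elems_eq_greatest[OF rank_preorder_total assms]
  by (auto simp: rank_preorder_def)

text \<open>Applied to sets inside one half, where one preorder ties all elements and the other has
  no ties.\<close>

lemma card_sym_diff_subsingleton:
  assumes "finite S" "M' \<subseteq> S" "\<And>x y. x \<in> M' \<Longrightarrow> y \<in> M' \<Longrightarrow> x = y"
  shows "card S \<le> card (sym_diff S M') + 1" and "card S \<le> card (sym_diff M' S) + 1"
proof -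
  have "finite M'" using assms(1,2) by (auto intro: finite_subset)
  then have "card M' \<le> 1" using assms(3) by (auto simp: card_le_Suc0_iff_eq)
  moreover have "sym_diff S M' = S - M'" "sym_diff M' S = S - M'" using assms by auto
  moreover have "card (S - M') = card S - card M'"
    using assms(2) \<open>finite M'\<close> by (simp add: card_Diff_subset)
  ultimately show "card S \<le> card (sym_diff S M') + 1" "card S \<le> card (sym_diff M' S) + 1"
    by simp_all
qed

lemma top_diff_ge_halves:
  assumes fin: "finite X" and AB: "A \<union> B = X" "A \<inter> B = {}"
    and f: "\<And>x. x \<in> A \<Longrightarrow> f x = 0" "\<And>x. x \<in> B \<Longrightarrow> f x > 0" "inj_on f B"
    and f': "\<And>x. x \<in> B \<Longrightarrow> f' x = 0" "\<And>x. x \<in> A \<Longrightarrow> f' x > 0" "inj_on f' A"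
  shows "int (card X) * 2 ^ (card X - 1) + 2 - 2 ^ card A - 2 ^ card B
    \<le> int (top_diff X (rank_preorder X f) (rank_preorder X f'))"
proof -
  let ?M = "\<lambda>S. maximal_elems S (rank_preorder X f)"
  let ?M' = "\<lambda>S. maximal_elems S (rank_preorder X f')"
  \<comment> \<open>The nonempty sets inside one half: they lose at most 1, and all other sets lose
    nothing.\<close>
  let ?L = "(Pow A - {{}}) \<union> (Pow B - {{}})"
  have finAB: "finite A" "finite B" using fin AB by auto
  have le: "int (card S) \<le> int (card (sym_diff (?M S) (?M' S))) + (if S \<in> ?L then 1 else 0)"
    if "S \<in> Pow X" for S
  proof -
    have SX: "S \<subseteq> X" and finS: "finite S" using that fin by (auto intro: finite_subset)
    note M = maximal_elems_rank_preorder[OF SX]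
    consider "S = {}" | "S \<noteq> {}" "S \<subseteq> A" | "S \<noteq> {}" "S \<subseteq> B" | "S \<inter> A \<noteq> {}" "S \<inter> B \<noteq> {}"
      using SX AB by blast
    then show ?thesis
    proof cases
      case 1
      then show ?thesis by simp
    next
      case 2
      have "?M S = S" unfolding M using 2 f(1) by fastforce
      moreover have "x = y" if "x \<in> ?M' S" "y \<in> ?M' S" for x y
        using that 2 unfolding M by (intro inj_onD[OF f'(3)] antisym) auto
      then have "card S \<le> card (sym_diff S (?M' S)) + 1"
        by (rule card_sym_diff_subsingleton(1)[OF finS maximal_elems_subset])
      moreover have "S \<in> ?L" using 2 by auto
      ultimately show ?thesis by (simp only: if_True)
    next
      case 3
      have "?M' S = S" unfolding M using 3 f'(1) by fastforce
      moreover have "x = y" if "x \<in> ?M S" "y \<in> ?M S" for x y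
        using that 3 unfolding M by (intro inj_onD[OF f(3)] antisym) auto
      then have "card S \<le> card (sym_diff (?M S) S) + 1"
        by (rule card_sym_diff_subsingleton(2)[OF finS maximal_elems_subset])
      moreover have "S \<in> ?L" using 3 by auto
      ultimately show ?thesis by (simp only: if_True)
    next
      case 4
      then obtain u v where uv: "u \<in> S" "u \<in> A" "v \<in> S" "v \<in> B" by auto
      have "?M S = S \<inter> A"
      proof
        show "?M S \<subseteq> S \<inter> A"
        proof
          fix x assume "x \<in> ?M S"
          then have "x \<in> S" "f x \<le> f u" using uv unfolding M by auto
          then show "x \<in> S \<inter> A" using f(1)[of u] f(2)[of x] uv SX AB by auto
        qed
        show "S \<inter> A \<subseteq> ?M S" unfolding M using f(1) by auto
      qed
      moreover have "?M' S = S \<inter> B"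
      proof
        show "?M' S \<subseteq> S \<inter> B"
        proof
          fix x assume "x \<in> ?M' S"
          then have "x \<in> S" "f' x \<le> f' v" using uv unfolding M by auto
          then show "x \<in> S \<inter> B" using f'(1)[of v] f'(2)[of x] uv SX AB by auto
        qed
        show "S \<inter> B \<subseteq> ?M' S" unfolding M using f'(1) by auto
      qed
      ultimately have "sym_diff (?M S) (?M' S) = S" using SX AB by blast
      then show ?thesis by simp
    qed
  qed
  have "(\<Sum>S\<in>Pow X. int (card S))
      \<le> (\<Sum>S\<in>Pow X. int (card (sym_diff (?M S) (?M' S))) + (if S \<in> ?L then 1 else 0))"
    using le by (intro sum_mono) blast
  moreover have "(\<Sum>S\<in>Pow X. if S \<in> ?L then 1 else 0 :: int) = int (card ?L)"
  proof -
    have "Pow X \<inter> ?L = ?L" using AB by auto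
    then show ?thesis using fin by (simp add: sum.If_cases Collect_mem_eq del: Diff_iff Un_iff)
  qed
  \<comment> \<open>With the empty set removed, the two families are disjoint.\<close>
  moreover have "card ?L = card (Pow A - {{}}) + card (Pow B - {{}})"
    using finAB AB by (intro card_Un_disjoint) auto
  then have "int (card ?L) = (2 ^ card A - 1) + (2 ^ card B - 1)"
    using finAB by (simp only: of_nat_add int_card_Pow_minus_empty)
  ultimately show ?thesis
    using sum_card_Pow[OF fin] by (simp add: sum.distrib top_diff_def)
qed

lemma ex_top_diff_ge:
  assumes fin: "finite X" and a: "1 \<le> a" "a \<le> card X"
  shows "\<exists>R\<in>total_preorders X. \<exists>R'\<in>total_preorders X.
    int (card X) * 2 ^ (card X - 1) + 2 - 2 ^ a - 2 ^ (card X - a) \<le> int (top_diff X R R')"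
proof -
  obtain A where A: "A \<subseteq> X" "card A = a" using obtain_subset_with_card_n[OF a(2)] by metis
  have finA: "finite A" using A fin by (auto intro: finite_subset)
  obtain h :: "'a \<Rightarrow> nat" where h: "inj_on h X"
    using finite_imp_inj_to_nat_seg[OF fin] by auto
  \<comment> \<open>The injection \<open>h\<close> makes the lower ranks distinct, and
    \<open>Suc\<close> keeps them strictly below the top class at rank 0.\<close>
  define f where "f x = (if x \<in> A then 0 else Suc (h x))" for x
  define f' where "f' x = (if x \<in> A then Suc (h x) else 0)" for x
  have "card (X - A) = card X - a" using A finA by (simp add: card_Diff_subset)
  moreover have "int (card X) * 2 ^ (card X - 1) + 2 - 2 ^ card A - 2 ^ card (X - A)
    \<le> int (top_diff X (rank_preorder X f) (rank_preorder X f'))"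
    using A h by (intro top_diff_ge_halves fin) (auto simp: f_def f'_def inj_on_def)
  ultimately show ?thesis using rank_preorder_total A by metis
qed

theorem theorem4p1:
  fixes X :: "'a set" and n :: nat
  assumes "finite X" and "n = card X" and "n \<ge> 2"
  shows "int (Max {top_diff X R R' | R R'. R \<in> total_preorders X \<and> R' \<in> total_preorders X})
    = int n * 2 ^ (n - 1) + 2 - 2 ^ nat \<lfloor>real n / 2\<rfloor> - 2 ^ nat \<lceil>real n / 2\<rceil>"
proof -
  let ?V = "{top_diff X R R' | R R'. R \<in> total_preorders X \<and> R' \<in> total_preorders X}"
  let ?b = "int n * 2 ^ (n - 1) + 2 - 2 ^ (n div 2) - 2 ^ (n - n div 2)"
  have V: "finite ?V" "?V \<noteq> {}" using top_diff_values_finite_nonempty[OF assms(1)] by blast+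
  have "Max ?V \<in> ?V" using V by (rule Max_in)
  then have "int (Max ?V) \<le> ?b" using top_diff_le[OF _ _ assms(1)] assms(2) by fastforce
  moreover have "?b \<le> int (Max ?V)"
  proof -
    have "1 \<le> n div 2" "n div 2 \<le> card X" using assms(2,3) by auto
    then obtain R R' where RR': "R \<in> total_preorders X" "R' \<in> total_preorders X"
      "?b \<le> int (top_diff X R R')"
      using ex_top_diff_ge[OF assms(1)] assms(2) by metis
    then have "top_diff X R R' \<le> Max ?V" using V by (intro Max_ge) auto
    then show ?thesis using RR' by linarith
  qed
  moreover have "nat \<lfloor>real n / 2\<rfloor> = n div 2" by linarith
  moreover have "nat \<lceil>real n / 2\<rceil> = n - n div 2" by linarith
  ultimately show ?thesis by simp
qed

end
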